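(* Let $F\subset k[x_1,\ldots,x_n]$ be a squarefree Cremona set in degree $2$ satisfying the canonical restrictions. Then $F$ is apocryphal if and only if it is of general type.
   Context: Let $k$ be a field and $n\ge 2$. For $v=(a_1,\ldots,a_n)\in\mathbb{N}^n$ write $\mathbf{x}^v=x_1^{a_1}\cdots x_n^{a_n}$. Let $F=\{\mathbf{x}^{v_1},\ldots,\mathbf{x}^{v_n}\}$ be a set of $n$ distinct monomials of the same degree; its log-matrix $A_F$ has $j$th column $v_j$. $F$ satisfies the canonical restrictions if the monomials have no non-trivial common factor and every variable divides at least one of them. $F$ is a Cremona set if the rational map $\mathbb{P}^{n-1}\dashrightarrow\mathbb{P}^{n-1}$ with coordinates $(\mathbf{x}^{v_1}:\cdots:\mathbf{x}^{v_n})$ is birational; it is in degree $2$ if the monomials have degree $2$, and squarefree if the monomials are squarefree. For a Cremona set $F$ satisfying the canonical restrictions, there are a unique set $F^{-1}$ of $n$ monomials of a common degree satisfying the canonical restrictions, with log-matrix $A_{F^{-1}}$, and a unique vector $\gamma\in\mathbb{N}^n$ such that $A_F\cdot A_{F^{-1}}=[\gamma|\cdots|\gamma]+I_n$; $F^{-1}$ defines the inverse map and is called the inverse set. $F$ is apocryphal if $F^{-1}$ contains at least one non-squarefree monomial. For $F$ squarefree in degree $2$, the simple graph $G_F$ has vertices $x_1,\ldots,x_n$ and an edge joining $x_i$ and $x_j$ for each $x_ix_j\in F$. For a squarefree Cremona set in degree $2$ satisfying the canonical restrictions, $G_F$ is connected with a unique circuit, which has odd length. The second neighborhood of the circuit is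 the set of vertices at distance $2$ from the circuit. $F$ is of short type if the circuit has empty second neighborhood; otherwise $F$ is of general type (also called long type). *)

theory Defs
  imports "HOL-Analysis.Analysis" "HOL-Library.Poly_Mapping" "HOL-Library.Extended_Nat"
begin

text \<open>
  The polynomial ring over \<open>'k\<close> in variables indexed by the finite type \<open>'n\<close> is the monoid algebra
  of the exponent monoid \<open>nat ^ 'n\<close>; the product on \<open>\<Rightarrow>\<^sub>0\<close> is convolution.
\<close>

type_synonym ('k, 'n) mpoly = "(nat ^ 'n) \<Rightarrow>\<^sub>0 'k"

definition monomial :: "nat ^ 'n \<Rightarrow> ('k::field, 'n::finite) mpoly" where
  "monomial v = Poly_Mapping.single v 1"

definition Var :: "'n \<Rightarrow> ('k::field, 'n::finite) mpoly" where
  "Var i = monomial (axis i 1)"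

definition mdeg :: "nat ^ 'n::finite \<Rightarrow> nat" where
  "mdeg v = (\<Sum>i\<in>UNIV. v $ i)"

definition homogeneous :: "nat \<Rightarrow> ('k::field, 'n::finite) mpoly \<Rightarrow> bool" where
  "homogeneous d p \<longleftrightarrow> (\<forall>u \<in> Poly_Mapping.keys p. mdeg u = d)"

definition subst :: "('n \<Rightarrow> ('k::field, 'n) mpoly) \<Rightarrow> ('k, 'n::finite) mpoly \<Rightarrow> ('k, 'n) mpoly" where
  "subst f p = (\<Sum>u\<in>Poly_Mapping.keys p.
     Poly_Mapping.single 0 (Poly_Mapping.lookup p u) * (\<Prod>i\<in>UNIV. f i ^ (u $ i)))"

text \<open>
  A rational self-map of projective space of dimension \<open>CARD('n) - 1\<close> is represented by a tuple of
  forms of one common degree, not all zero; two tuples represent the same map iff they are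
  proportional over the field of fractions.
\<close>

definition rational_map :: "('n \<Rightarrow> ('k::field, 'n::finite) mpoly) \<Rightarrow> bool" where
  "rational_map f \<longleftrightarrow> (\<exists>d. \<forall>i. homogeneous d (f i)) \<and> (\<exists>i. f i \<noteq> 0)"

definition same_rational_map ::
    "('n \<Rightarrow> ('k::field, 'n::finite) mpoly) \<Rightarrow> ('n \<Rightarrow> ('k, 'n) mpoly) \<Rightarrow> bool" where
  "same_rational_map f g \<longleftrightarrow> (\<forall>i j. f i * g j = f j * g i)"

definition compose_map ::
    "('n \<Rightarrow> ('k::field, 'n::finite) mpoly) \<Rightarrow> ('n \<Rightarrow> ('k, 'n) mpoly) \<Rightarrow> ('n \<Rightarrow> ('k, 'n) mpoly)" where
  "compose_map g f = (\<lambda>i. subst f (g i))"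

text \<open>The conditions \<open>rational_map (compose_map _ _)\<close> say that the composites are defined.\<close>

definition birational :: "('n \<Rightarrow> ('k::field, 'n::finite) mpoly) \<Rightarrow> bool" where
  "birational f \<longleftrightarrow> rational_map f \<and>
     (\<exists>g. rational_map g \<and>
        rational_map (compose_map g f) \<and> same_rational_map (compose_map g f) Var \<and>
        rational_map (compose_map f g) \<and> same_rational_map (compose_map f g) Var)"

text \<open>
  A set of \<open>CARD('n)\<close> monomials is given by the injective family \<open>v\<close> of its exponent vectors.
  The enumeration is kept because the log-matrix, the rational map and the inverse set refer to it.
\<close>

definition equigenerated :: "('n::finite \<Rightarrow> nat ^ 'n) \<Rightarrow> bool" where
  "equigenerated v \<longleftrightarrow> inj v \<and> (\<exists>d. \<forall>j. mdeg (v j) = d)"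

definition in_degree :: "nat \<Rightarrow> ('n::finite \<Rightarrow> nat ^ 'n) \<Rightarrow> bool" where
  "in_degree d v \<longleftrightarrow> (\<forall>j. mdeg (v j) = d)"

definition squarefree_monomial :: "nat ^ 'n::finite \<Rightarrow> bool" where
  "squarefree_monomial v \<longleftrightarrow> (\<forall>i. v $ i \<le> 1)"

definition squarefree_set :: "('n::finite \<Rightarrow> nat ^ 'n) \<Rightarrow> bool" where
  "squarefree_set v \<longleftrightarrow> (\<forall>j. squarefree_monomial (v j))"

definition monomial_dvd :: "nat ^ 'n::finite \<Rightarrow> nat ^ 'n \<Rightarrow> bool" where
  "monomial_dvd u v \<longleftrightarrow> (\<forall>i. u $ i \<le> v $ i)"

definition canonical_restrictions :: "('n::finite \<Rightarrow> nat ^ 'n) \<Rightarrow> bool" where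
  "canonical_restrictions v \<longleftrightarrow>
     (\<forall>u. (\<forall>j. monomial_dvd u (v j)) \<longrightarrow> u = 0) \<and>
     (\<forall>i. \<exists>j. monomial_dvd (axis i 1) (v j))"

definition cremona_set :: "'k::field itself \<Rightarrow> ('n::finite \<Rightarrow> nat ^ 'n) \<Rightarrow> bool" where
  "cremona_set _ v \<longleftrightarrow>
     equigenerated v \<and> birational (\<lambda>j. monomial (v j) :: ('k, 'n) mpoly)"

definition log_matrix :: "('n::finite \<Rightarrow> nat ^ 'n) \<Rightarrow> nat ^ 'n ^ 'n" where
  "log_matrix v = (\<chi> i j. v j $ i)"

definition is_inverse_set :: "('n::finite \<Rightarrow> nat ^ 'n) \<Rightarrow> ('n \<Rightarrow> nat ^ 'n) \<Rightarrow> bool" where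
  "is_inverse_set v w \<longleftrightarrow> equigenerated w \<and> canonical_restrictions w \<and>
     (\<exists>\<gamma> :: nat ^ 'n. log_matrix v ** log_matrix w = (\<chi> i j. \<gamma> $ i) + mat 1)"

definition inverse_set :: "('n::finite \<Rightarrow> nat ^ 'n) \<Rightarrow> ('n \<Rightarrow> nat ^ 'n)" where
  "inverse_set v = (THE w. is_inverse_set v w)"

definition apocryphal :: "('n::finite \<Rightarrow> nat ^ 'n) \<Rightarrow> bool" where
  "apocryphal v \<longleftrightarrow> (\<exists>j. \<not> squarefree_monomial (inverse_set v j))"

text \<open>Simple graphs on the vertex set \<open>UNIV :: 'n set\<close> are given by their edges, as two-element sets.\<close>

definition graph_edges :: "('n::finite \<Rightarrow> nat ^ 'n) \<Rightarrow> 'n set set" where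
  "graph_edges v = {{i, j} | i j. i \<noteq> j \<and> axis i 1 + axis j 1 \<in> range v}"

definition is_circuit :: "'a set set \<Rightarrow> 'a set set \<Rightarrow> bool" where
  "is_circuit E C \<longleftrightarrow> C \<subseteq> E \<and>
     (\<exists>p. distinct p \<and> length p \<ge> 3 \<and>
        C = {{p ! l, p ! (Suc l mod length p)} | l. l < length p})"

definition the_circuit :: "'a set set \<Rightarrow> 'a set set" where
  "the_circuit E = (THE C. is_circuit E C)"

definition adj_rel :: "'a set set \<Rightarrow> ('a \<times> 'a) set" where
  "adj_rel E = {(x, y). {x, y} \<in> E}"

definition dist_from :: "'a set set \<Rightarrow> 'a set \<Rightarrow> 'a \<Rightarrow> enat" where
  "dist_from E S y = (INF l \<in> {l. \<exists>x\<in>S. (x, y) \<in> adj_rel E ^^ l}. enat l)"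

definition second_neighborhood :: "'a set set \<Rightarrow> 'a set \<Rightarrow> 'a set" where
  "second_neighborhood E S = {y. dist_from E S y = 2}"

definition short_type :: "('n::finite \<Rightarrow> nat ^ 'n) \<Rightarrow> bool" where
  "short_type v \<longleftrightarrow>
     second_neighborhood (graph_edges v) (\<Union> (the_circuit (graph_edges v))) = {}"

definition general_type :: "('n::finite \<Rightarrow> nat ^ 'n) \<Rightarrow> bool" where
  "general_type v \<longleftrightarrow> \<not> short_type v"

end

theory Submission
  imports Defs
begin

text \<open>
  Birationality enters through a lattice: comparing exponents in the composite with an inverse map
  shows that every \<open>e\<^sub>i - e\<^sub>j\<close> is an integral combination of the exponent vectors \<open>v\<^sub>l\<close>
  (\<open>birational_monomials_lattice\<close>). For squarefree monomials of degree two the log-matrix is the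
  incidence matrix of the graph, so it is invertible and twice its inverse \<open>T\<close> is integral
  (\<open>cremona_half_integral_incidence\<close>).

  Row \<open>k\<close> of \<open>T\<close> is a function on the vertices that changes sign along every edge but \<open>k\<close> and whose
  values at the two ends of \<open>k\<close> sum to \<open>2\<close>. These sign rules and the integrality carry all of the
  graph theory:
  connectedness, existence, oddness and uniqueness of the circuit follow from them. If \<open>k\<close> is on the
  circuit, row \<open>k\<close> takes the values \<open>1\<close> and \<open>-1\<close> only. Otherwise \<open>k\<close> is a bridge; row \<open>k\<close> is \<open>0\<close> on
  the side of the circuit and alternates between \<open>2\<close> and \<open>-2\<close> on the other side, starting with \<open>2\<close>
  at the end of \<open>k\<close>. The value \<open>-2\<close>, and with it a spread of \<open>4\<close>, occurs just if some edge continues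
  beyond \<open>k\<close>, that is, if there are vertices at distance two from the circuit
  (\<open>wide_potential_iff_second_neighborhood\<close>).

  On the other hand the exponent of the variable \<open>k\<close> in the monomial \<open>j\<close> of the inverse set is half of
  \<open>T k j\<close> minus the minimum of row \<open>k\<close> (\<open>inverse_set_entries\<close>). It is at least two for some \<open>j\<close> if and
  only if row \<open>k\<close> has a spread of at least \<open>4\<close>.
\<close>

section \<open>Exponents of composites with a monomial map\<close>

lemma lookup_times_monomial:
  fixes p :: "('k::field, 'n::finite) mpoly"
  shows "Poly_Mapping.lookup (p * monomial v) (u + v) = Poly_Mapping.lookup p u"
proof -
  have "p = (\<Sum>a\<in>Poly_Mapping.keys p. Poly_Mapping.single a (Poly_Mapping.lookup p a))"
    by (rule poly_mapping_eqI)
       (auto simp: lookup_sum lookup_single when_def in_keys_iff)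
  then have "p * monomial v =
      (\<Sum>a\<in>Poly_Mapping.keys p. Poly_Mapping.single a (Poly_Mapping.lookup p a)) * monomial v"
    by simp
  also have "\<dots> = (\<Sum>a\<in>Poly_Mapping.keys p. Poly_Mapping.single (a + v) (Poly_Mapping.lookup p a))"
    by (simp add: sum_distrib_right monomial_def mult_single)
  finally show ?thesis
    by (auto simp: lookup_sum lookup_single when_def in_keys_iff)
qed

text \<open>
  For general factors only an inclusion holds, since terms may cancel. A single term only shifts the
  exponents, so the product with it keeps all of them and is nonzero if \<open>p\<close> is.
\<close>

lemma keys_times_monomial:
  fixes p :: "('k::field, 'n::finite) mpoly"
  shows "Poly_Mapping.keys (p * monomial v) = (\<lambda>u. u + v) ` Poly_Mapping.keys p"
proof
  show "Poly_Mapping.keys (p * monomial v) \<subseteq> (\<lambda>u. u + v) ` Poly_Mapping.keys p"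
    using keys_mult[of p "monomial v"] by (auto simp: monomial_def)
next
  show "(\<lambda>u. u + v) ` Poly_Mapping.keys p \<subseteq> Poly_Mapping.keys (p * monomial v)"
    by (auto simp: in_keys_iff lookup_times_monomial)
qed

lemma prod_monomial_powers:
  fixes v :: "'n::finite \<Rightarrow> nat ^ 'n"
  shows "(\<Prod>l\<in>S. (monomial (v l) :: ('k::field, 'n) mpoly) ^ (u l))
    = monomial (\<chi> x. \<Sum>l\<in>S. u l * v l $ x)"
proof -
  have power: "(monomial a :: ('k, 'n) mpoly) ^ m = monomial (\<chi> x. m * a $ x)" for a m
  proof (induction m)
    case 0
    have "(\<chi> x. 0) = (0 :: nat ^ 'n)" by (simp add: vec_eq_iff)
    then show ?case by (simp add: monomial_def)
  next
    case (Suc m)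
    have "a + (\<chi> x. m * a $ x) = (\<chi> x. Suc m * a $ x)" by (simp add: vec_eq_iff)
    then show ?case using Suc by (simp add: monomial_def mult_single)
  qed
  show ?thesis
  proof (induction S rule: infinite_finite_induct)
    case (insert l S)
    have "(\<chi> x. u l * v l $ x) + (\<chi> x. \<Sum>l\<in>S. u l * v l $ x)
        = (\<chi> x. \<Sum>l\<in>insert l S. u l * v l $ x)"
      using insert by (simp add: vec_eq_iff)
    then show ?case using insert by (simp add: power) (simp add: monomial_def mult_single)
  next
    case empty
    have "(\<chi> x. 0) = (0 :: nat ^ 'n)" by (simp add: vec_eq_iff)
    then show ?case by (simp add: monomial_def)
  next
    case (infinite S)
    then show ?case by simp
  qed
qed

lemma keys_subst_monomials:
  fixes v :: "'n::finite \<Rightarrow> nat ^ 'n" and p :: "('k::field, 'n) mpoly"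
  assumes "m \<in> Poly_Mapping.keys (subst (\<lambda>l. monomial (v l)) p)"
  obtains u :: "nat ^ 'n" where "\<And>x. m $ x = (\<Sum>l\<in>UNIV. u $ l * v l $ x)"
proof -
  obtain u where "m \<in> Poly_Mapping.keys
      (Poly_Mapping.single 0 (Poly_Mapping.lookup p u)
         * monomial (\<chi> x. \<Sum>l\<in>UNIV. u $ l * v l $ x))"
    using assms keys_sum unfolding subst_def prod_monomial_powers by fastforce
  then have "m = (\<chi> x. \<Sum>l\<in>UNIV. u $ l * v l $ x)"
    by (auto simp: keys_times_monomial split: if_splits)
  then show thesis by (intro that[of u]) simp
qed

text \<open>
  If \<open>g\<close> inverts the monomial map, every \<open>h\<^sub>i = g\<^sub>i(x\<^bsup>v\<^esup>)\<close> has all its exponents in the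
  monoid generated by the \<open>v\<^sub>l\<close>, and \<open>h\<^sub>i x\<^sub>j = h\<^sub>j x\<^sub>i\<close>. An exponent \<open>m\<close> of \<open>h\<^sub>c\<close> therefore
  yields an exponent \<open>m'\<close> of \<open>h\<^sub>i\<close> with \<open>m' - m = e\<^sub>i - e\<^sub>c\<close>, and the difference of the two
  coordinate vectors of \<open>m'\<close> and \<open>m\<close> is an integral solution.
\<close>

lemma birational_monomials_lattice:
  fixes v :: "'n::finite \<Rightarrow> nat ^ 'n"
  assumes "birational (\<lambda>j. monomial (v j) :: ('k::field, 'n) mpoly)"
  obtains z :: "'n \<Rightarrow> int" where
    "\<And>x. (\<Sum>l\<in>UNIV. int (v l $ x) * z l) = (if x = a then 1 else 0) - (if x = b then 1 else 0)"
proof -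
  let ?f = "\<lambda>j. monomial (v j) :: ('k, 'n) mpoly"
  obtain g where def: "rational_map (compose_map g ?f)"
    and same: "same_rational_map (compose_map g ?f) Var"
    using assms unfolding birational_def by blast
  define h where "h = compose_map g ?f"
  obtain c where c: "h c \<noteq> 0"
    using def unfolding h_def rational_map_def by blast
  have hx: "h i * monomial (axis j 1) = h j * monomial (axis i 1)" for i j
    using same unfolding h_def same_rational_map_def Var_def by blast
  have hk: "\<exists>u :: nat ^ 'n. \<forall>x. m $ x = (\<Sum>l\<in>UNIV. u $ l * v l $ x)"
    if "m \<in> Poly_Mapping.keys (h i)" for i m
    using that keys_subst_monomials unfolding h_def compose_map_def by metis
  have step: "\<exists>z :: 'n \<Rightarrow> int. \<forall>x. (\<Sum>l\<in>UNIV. int (v l $ x) * z l)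
      = (if x = i then 1 else 0) - (if x = c then 1 else 0)" for i
  proof -
    obtain m where m: "m \<in> Poly_Mapping.keys (h c)"
      using c by (metis ex_in_conv keys_eq_empty)
    then have "m + axis i 1 \<in> Poly_Mapping.keys (h i * monomial (axis c 1))"
      unfolding hx[of i c] keys_times_monomial by blast
    then obtain m' where m': "m' \<in> Poly_Mapping.keys (h i)" and eq: "m + axis i 1 = m' + axis c 1"
      unfolding keys_times_monomial by blast
    obtain u u' :: "nat ^ 'n" where u: "\<And>x. m $ x = (\<Sum>l\<in>UNIV. u $ l * v l $ x)"
      and u': "\<And>x. m' $ x = (\<Sum>l\<in>UNIV. u' $ l * v l $ x)"
      using hk[OF m] hk[OF m'] by blast
    have "(\<Sum>l\<in>UNIV. int (v l $ x) * (int (u' $ l) - int (u $ l)))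
      = (if x = i then 1 else 0) - (if x = c then 1 else 0)" for x
    proof -
      have "int (m $ x) + (if x = i then 1 else 0) = int (m' $ x) + (if x = c then 1 else 0)"
        using arg_cong[OF eq, of "\<lambda>w. int (w $ x)"] by (auto simp: axis_def)
      moreover have "(\<Sum>l\<in>UNIV. int (v l $ x) * (int (u' $ l) - int (u $ l)))
          = int (m' $ x) - int (m $ x)"
        unfolding u u' by (simp add: right_diff_distrib sum_subtractf mult.commute)
      ultimately show ?thesis by simp
    qed
    then show ?thesis by (intro exI allI)
  qed
  obtain za zb :: "'n \<Rightarrow> int"
    where "\<And>x. (\<Sum>l\<in>UNIV. int (v l $ x) * za l) = (if x = a then 1 else 0) - (if x = c then 1 else 0)"
      and "\<And>x. (\<Sum>l\<in>UNIV. int (v l $ x) * zb l) = (if x = b then 1 else 0) - (if x = c then 1 else 0)"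
    using step[of a] step[of b] by blast
  then show thesis
    by (intro that[of "\<lambda>l. za l - zb l"]) (simp add: right_diff_distrib sum_subtractf)
qed

section \<open>Circuits and second neighborhoods\<close>

text \<open>
  The first vertex of a longest path has a second neighbor; by maximality it lies on the path, and
  the initial segment up to it closes up.
\<close>

lemma circuit_of_min_degree_two:
  fixes F :: "'v::finite set set"
  assumes card: "\<And>e. e \<in> F \<Longrightarrow> card e = 2" and ne: "F \<noteq> {}"
    and deg: "\<And>e y. e \<in> F \<Longrightarrow> y \<in> e \<Longrightarrow> \<exists>e'\<in>F. e' \<noteq> e \<and> y \<in> e'"
  shows "\<exists>C. is_circuit F C"
proof -
  define path where "path p \<longleftrightarrow> distinct p \<and> length p \<ge> 2 \<and>
    (\<forall>i. Suc i < length p \<longrightarrow> {p ! i, p ! Suc i} \<in> F)" for p :: "'v list"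
  obtain e where "e \<in> F" using ne by blast
  then obtain x y where "e = {x, y}" "x \<noteq> y" using card card_2_iff by metis
  with \<open>e \<in> F\<close> have "path [x, y]" by (simp add: path_def)
  moreover have "\<forall>p. path p \<longrightarrow> length p < Suc (CARD('v))"
    by (metis card_mono distinct_card finite le_imp_less_Suc path_def subset_UNIV)
  ultimately obtain p where p: "path p" and longest: "\<And>q. path q \<Longrightarrow> length q \<le> length p"
    using ex_has_greatest_nat[of path _ length] by blast
  define a where "a = p ! 0"
  have len: "length p \<ge> 2" and dist: "distinct p"
    and steps: "\<And>i. Suc i < length p \<Longrightarrow> {p ! i, p ! Suc i} \<in> F"
    using p by (auto simp: path_def)
  have "{a, p ! 1} \<in> F" using steps[of 0] len by (simp add: a_def)
  then obtain e' where e': "e' \<in> F" "e' \<noteq> {a, p ! 1}" "a \<in> e'" using deg by blast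
  then obtain c where c: "e' = {a, c}" "c \<noteq> a" using card by (metis card_2_iff insert_iff insert_commute singletonD)
  have "c \<in> set p"
  proof (rule ccontr)
    assume "c \<notin> set p"
    then have "path (c # p)"
      using len dist steps e' c
      by (auto simp: path_def nth_Cons a_def insert_commute split: nat.splits)
    then show False using longest by fastforce
  qed
  then obtain i where i: "i < length p" "c = p ! i" by (metis in_set_conv_nth)
  have "i \<noteq> 0" "i \<noteq> 1" using i c e' by (auto simp: a_def)
  let ?q = "take (Suc i) p"
  have "{{?q ! l, ?q ! (Suc l mod length ?q)} | l. l < length ?q} \<subseteq> F"
  proof clarify
    fix l assume "l < length ?q"
    then have l: "l < Suc i" by simp
    have lq: "length ?q = Suc i" using i by simp
    show "{?q ! l, ?q ! (Suc l mod length ?q)} \<in> F"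
    proof (cases "l = i")
      \<comment> \<open>The index wraps around to \<open>0\<close>, which gives the edge \<open>e'\<close> back to the first vertex.\<close>
      case True
      then show ?thesis using e' c i lq by (simp add: a_def insert_commute)
    next
      case False
      then show ?thesis using steps[of l] l i lq by simp
    qed
  qed
  moreover have "distinct ?q" "length ?q \<ge> 3" using dist i \<open>i \<noteq> 0\<close> \<open>i \<noteq> 1\<close> by auto
  ultimately show ?thesis unfolding is_circuit_def by blast
qed

text \<open>
  A circuit through \<open>e\<close> with \<open>e\<close> rotated to the closing position: what remains is a path joining
  the ends of \<open>e\<close> that avoids \<open>e\<close>. Propagation arguments along that path then never meet \<open>e\<close>.
\<close>

lemma circuit_through_edge:
  assumes "is_circuit F C" "e \<in> C"
  obtains q m where "m \<ge> 3" "e = {q (m - 1), q 0}"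
    "\<And>i. Suc i < m \<Longrightarrow> {q i, q (Suc i)} \<in> C - {e}"
proof -
  obtain p where p: "distinct p" "length p \<ge> 3"
    and C: "C = {{p ! l, p ! (Suc l mod length p)} | l. l < length p}"
    using assms unfolding is_circuit_def by blast
  define m where "m = length p"
  obtain s where s: "s < m" "e = {p ! s, p ! (Suc s mod m)}"
    using assms(2) C m_def by blast
  define q where "q i = p ! ((Suc s + i) mod m)" for i
  have m3: "m \<ge> 3" using p m_def by simp
  have inj: "i = j" if "q i = q j" "i < m" "j < m" for i j
  proof -
    have "(Suc s + i) mod m = (Suc s + j) mod m"
      using that(1) p(1) m3 unfolding q_def
      by (subst (asm) nth_eq_iff_index_eq) (auto simp: m_def intro!: mod_less_divisor)
    then have "i mod m = j mod m"
      unfolding nat_mod_eq_iff by (metis add.assoc add_left_cancel)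
    then show "i = j" using that by simp
  qed
  have e: "e = {q (m - 1), q 0}"
  proof -
    have "Suc s + (m - 1) = s + m" using m3 by simp
    then have "(Suc s + (m - 1)) mod m = s" using s(1) by simp
    then show ?thesis using s(2) by (simp add: q_def)
  qed
  have "{q i, q (Suc i)} \<in> C - {e}" if "Suc i < m" for i
  proof -
    have "{q i, q (Suc i)} \<in> C"
      unfolding C q_def m_def[symmetric]
      using m3 by (auto intro!: exI[of _ "(Suc s + i) mod m"] simp: mod_Suc_eq)
    moreover have "{q i, q (Suc i)} \<noteq> e"
      unfolding e using inj[of i "m - 1"] inj[of i 0] inj[of "Suc i" "m - 1"] that m3
      by (auto simp: doubleton_eq_iff)
    ultimately show ?thesis by simp
  qed
  with m3 e show thesis by (rule that)
qed

lemma circuit_nonempty: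
  assumes "is_circuit F C"
  obtains x where "x \<in> \<Union>C"
proof -
  obtain p where "length p \<ge> 3" and C: "C = {{p ! l, p ! (Suc l mod length p)} | l. l < length p}"
    using assms unfolding is_circuit_def by blast
  then have "0 < length p" by linarith
  then have "p ! 0 \<in> \<Union>C" unfolding C by blast
  then show thesis by (rule that)
qed

lemma second_neighborhood_iff:
  "y \<in> second_neighborhood F S \<longleftrightarrow>
     y \<notin> S \<and> (\<forall>x\<in>S. {x, y} \<notin> F) \<and> (\<exists>x\<in>S. \<exists>s. {x, s} \<in> F \<and> {s, y} \<in> F)"
proof -
  define L where "L = {l. \<exists>x\<in>S. (x, y) \<in> adj_rel F ^^ l}"
  have mem: "0 \<in> L \<longleftrightarrow> y \<in> S" "1 \<in> L \<longleftrightarrow> (\<exists>x\<in>S. {x, y} \<in> F)"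
    "2 \<in> L \<longleftrightarrow> (\<exists>x\<in>S. \<exists>s. {x, s} \<in> F \<and> {s, y} \<in> F)"
    by (auto simp: L_def adj_rel_def numeral_2_eq_2)
  have "(INF l\<in>L. enat l) = 2 \<longleftrightarrow> 2 \<in> L \<and> 0 \<notin> L \<and> 1 \<notin> L"
  proof
    assume inf: "(INF l\<in>L. enat l) = 2"
    have low: "2 \<le> enat l" if "l \<in> L" for l using inf that INF_lower[of l L enat] by simp
    have "L \<noteq> {}" using inf by (auto simp: top_enat_def)
    then have "(INF l\<in>L. enat l) \<in> enat ` L"
      unfolding Inf_enat_def by (auto intro: LeastI)
    then have "2 \<in> L" using inf by (metis enat_numeral enat.inject imageE)
    then show "2 \<in> L \<and> 0 \<notin> L \<and> 1 \<notin> L"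
      using low[of 0] low[of 1] by (auto simp: zero_enat_def[symmetric] one_enat_def[symmetric])
  next
    assume L: "2 \<in> L \<and> 0 \<notin> L \<and> 1 \<notin> L"
    have "2 \<le> l" if "l \<in> L" for l using L that by (cases l; cases "l - 1") auto
    then have "2 \<le> (INF l\<in>L. enat l)"
      by (intro INF_greatest) (metis enat_ord_simps(1) enat_numeral)
    moreover have "(INF l\<in>L. enat l) \<le> 2" using L INF_lower[of 2 L enat] by (simp add: numeral_eq_enat)
    ultimately show "(INF l\<in>L. enat l) = 2" by simp
  qed
  then show ?thesis
    using mem unfolding second_neighborhood_def dist_from_def L_def by auto
qed

section \<open>The doubled inverse of an incidence matrix\<close>

text \<open>
  Pairing with a row of a left inverse recovers a coordinate from an image. The factor \<open>2\<close> keeps the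
  computation within the integers.
\<close>

lemma left_inverse_pairing:
  fixes E :: "'e::finite \<Rightarrow> 'v::finite set" and t :: "'v \<Rightarrow> int"
  assumes inv: "\<And>l. (\<Sum>x\<in>E l. t x) = (if k = l then 2 else 0)"
  shows "(\<Sum>x\<in>UNIV. t x * (\<Sum>l | x \<in> E l. f l)) = 2 * f k"
proof -
  have "(\<Sum>x\<in>UNIV. t x * (\<Sum>l | x \<in> E l. f l)) = (\<Sum>l\<in>UNIV. \<Sum>x\<in>E l. t x * f l)"
    using sum.swap_restrict[of UNIV UNIV "\<lambda>x l. t x * f l" "\<lambda>x l. x \<in> E l"]
    by (simp add: sum_distrib_left)
  also have "\<dots> = (\<Sum>l\<in>UNIV. if k = l then 2 * f l else 0)"
    by (rule sum.cong) (simp_all add: sum_distrib_right[symmetric] inv)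
  finally show ?thesis by simp
qed

text \<open>
  \<open>T\<close> is twice the inverse of the vertex-edge incidence matrix of \<open>E\<close>: \<open>potential\<close> and \<open>dual\<close> are
  the two inverse laws, entrywise, with \<open>2\<close> in place of \<open>1\<close>.
  The row \<open>T k\<close> is read as a potential on the vertices that changes
  sign along every edge except \<open>k\<close>, where its two values sum to \<open>2\<close>. By \<open>parity\<close> all differences
  \<open>e\<^sub>x - e\<^sub>y\<close> lie in the lattice spanned by the edges, which is what birationality provides.
\<close>

locale half_integral_incidence =
  fixes E :: "'e::finite \<Rightarrow> 'v::finite set" and T :: "'e \<Rightarrow> 'v \<Rightarrow> int"
  assumes card_edge: "card (E l) = 2"
    and potential: "E l = {a, b} \<Longrightarrow> T k a + T k b = (if k = l then 2 else 0)"
    and dual: "(\<Sum>k | x \<in> E k. T k y) = (if x = y then 2 else 0)"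
    and parity: "even (T k x - T k y)"
begin

lemma inj_edges: "inj E"
proof
  fix k l assume "E k = E l"
  moreover obtain a b where "E k = {a, b}" using card_edge card_2_iff by metis
  ultimately show "k = l"
    using potential[of k a b k] potential[of l a b k] by (auto split: if_splits)
qed

lemma abs_potential:
  assumes "E l = {a, b}" "l \<noteq> k"
  shows "\<bar>T k a\<bar> = \<bar>T k b\<bar>"
proof -
  have "T k a = - T k b" using potential[OF assms(1), of k] assms(2) by simp
  then show ?thesis by simp
qed

lemma sum_incidence:
  "(\<Sum>x\<in>S. \<Sum>k | x \<in> E k. f k) = (\<Sum>k\<in>UNIV. int (card (S \<inter> E k)) * f k)"
proof -
  have "(\<Sum>x\<in>S. \<Sum>k | x \<in> E k. f k) = (\<Sum>k\<in>UNIV. \<Sum>x | x \<in> S \<and> x \<in> E k. f k)"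
    using sum.swap_restrict[of S UNIV "\<lambda>x k. f k" "\<lambda>x k. x \<in> E k"] by simp
  then show ?thesis by (simp add: Int_def)
qed

lemma solve_incidence: "(\<Sum>x\<in>UNIV. T k x * (\<Sum>l | x \<in> E l. f l)) = 2 * f k"
proof (rule left_inverse_pairing)
  fix l
  obtain a b where "E l = {a, b}" "a \<noteq> b" using card_edge card_2_iff by metis
  then show "(\<Sum>x\<in>E l. T k x) = (if k = l then 2 else 0)"
    using potential[of l a b k] by simp
qed

lemma column_sum: "(\<Sum>k\<in>UNIV. T k y) = 1"
proof -
  have "(\<Sum>k\<in>UNIV. 2 * T k y) = (\<Sum>x\<in>UNIV. \<Sum>k | x \<in> E k. T k y)"
    unfolding sum_incidence by (simp add: card_edge)
  also have "\<dots> = 2" by (simp add: dual)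
  finally show ?thesis by (simp add: sum_distrib_left[symmetric])
qed

text \<open>
  If no edge left \<open>S\<close>, every edge would have \<open>0\<close> or \<open>2\<close> ends in \<open>S\<close>, so summing the coordinates in
  \<open>S\<close> of any lattice vector would give an even number; but \<open>e\<^sub>a - e\<^sub>b\<close> has the sum \<open>1\<close>. With the
  doubled coordinates the contradiction appears modulo \<open>4\<close>.
\<close>

lemma leaving_edge:
  assumes "a \<in> S" "b \<notin> S"
  obtains l x y where "E l = {x, y}" "x \<in> S" "y \<notin> S"
proof (rule ccontr)
  assume no: "\<not> thesis"
  have "4 dvd int (card (S \<inter> E k)) * (T k a - T k b)" for k
  proof -
    obtain x y where xy: "E k = {x, y}" "x \<noteq> y" using card_edge card_2_iff by metis
    then have "x \<in> S \<longleftrightarrow> y \<in> S" using no that[of k x y] that[of k y x] by (auto simp: insert_commute)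
    then have "S \<inter> E k = {} \<or> S \<inter> E k = E k" using xy by auto
    then show ?thesis
    proof
      assume "S \<inter> E k = E k"
      moreover obtain c where "T k a - T k b = 2 * c" using parity by blast
      ultimately show ?thesis using card_edge by simp
    qed simp
  qed
  then have "4 dvd (\<Sum>k\<in>UNIV. int (card (S \<inter> E k)) * (T k a - T k b))" by (rule dvd_sum)
  moreover have "(\<Sum>k\<in>UNIV. int (card (S \<inter> E k)) * (T k a - T k b))
      = (\<Sum>x\<in>S. (if x = a then 2 else 0)) - (\<Sum>x\<in>S. (if x = b then 2 else 0))"
    unfolding sum_incidence[symmetric] by (simp add: sum_subtractf dual)
  ultimately show False using assms by simp
qed

text \<open>
  The edges with odd coordinate in the representation of \<open>2 e\<^sub>x\<close> for one vertex \<open>x\<close> meet every vertex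
  an even number of times, and there are such edges because the coordinates sum to \<open>1\<close>. Hence they
  form a nonempty graph without vertices of degree one.
\<close>

lemma circuit_exists: "\<exists>C. is_circuit (range E) C"
proof -
  obtain root :: 'v where True by simp
  define K where "K = {k. odd (T k root)}"
  have "K \<noteq> {}"
  proof
    assume "K = {}"
    then have "even (\<Sum>k\<in>UNIV. T k root)" by (intro dvd_sum) (auto simp: K_def)
    then show False by (simp add: column_sum)
  qed
  have deg: "\<exists>l\<in>K. l \<noteq> k \<and> y \<in> E l" if "k \<in> K" "y \<in> E k" for k y
  proof (rule ccontr)
    assume "\<not> ?thesis"
    then have "{l \<in> {l. y \<in> E l}. odd (T l root)} = {k}" using that by (auto simp: K_def)
    then have "odd (\<Sum>l | y \<in> E l. T l root)" by (subst even_sum_iff) auto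
    then show False by (simp add: dual split: if_splits)
  qed
  obtain C where "is_circuit (E ` K) C"
  proof (atomize_elim, rule circuit_of_min_degree_two)
    show "\<exists>e'\<in>E ` K. e' \<noteq> e \<and> y \<in> e'" if "e \<in> E ` K" "y \<in> e" for e y
      using that deg inj_edges by (auto simp: inj_eq)
  qed (use \<open>K \<noteq> {}\<close> card_edge in auto)
  then have "is_circuit (range E) C" unfolding is_circuit_def by blast
  then show ?thesis ..
qed

text \<open>
  Along the path from one end of \<open>e\<close> to the other through the circuit the potential alternates in
  sign. For the potential of \<open>e\<close> itself the two end values sum to \<open>2\<close>, which excludes an odd number
  of sign changes; so the circuit is odd and both end values agree. Then they are \<open>1\<close> for the
  potential of \<open>e\<close>, and \<open>0\<close> for that of an edge outside the circuit.
\<close>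

lemma circuit_potential:
  assumes C: "is_circuit (range E) C" and e: "e \<in> C" and k: "E k \<notin> C - {e}" and x: "x \<in> e"
  shows "T k x = (if E k = e then 1 else 0)"
proof -
  obtain q m where "m \<ge> 3" and eq: "e = {q (m - 1), q 0}"
    and path: "\<And>i. Suc i < m \<Longrightarrow> {q i, q (Suc i)} \<in> C - {e}"
    using circuit_through_edge[OF C e] by metis
  have CE: "C \<subseteq> range E" using C by (simp add: is_circuit_def)
  have alt: "T j (q i) = (-1) ^ i * T j (q 0)" if "E j \<notin> C - {e}" "i < m" for i j
    using that
  proof (induction i)
    case (Suc i)
    obtain l where l: "E l = {q i, q (Suc i)}" using path[of i] Suc.prems CE by (metis DiffD1 imageE subsetD)
    have "j \<noteq> l" using path[OF Suc.prems(2)] Suc.prems(1) l by metis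
    with potential[OF l, of j] Suc show ?case by simp
  qed simp
  obtain k0 where k0: "E k0 = e" using CE e by blast
  then have "T k0 (q (m - 1)) + T k0 (q 0) = 2" using potential[of k0 "q (m - 1)" "q 0" k0] eq by simp
  with alt[of k0 "m - 1"] \<open>m \<ge> 3\<close> k0 have "even (m - 1)" by (cases "even (m - 1)") auto
  then have "T k (q (m - 1)) = T k (q 0)" using alt[OF k, of "m - 1"] \<open>m \<ge> 3\<close> by simp
  moreover have "E k = e \<longleftrightarrow> k = k0" using k0 injD[OF inj_edges] by metis
  moreover have "T k (q (m - 1)) + T k (q 0) = (if k = k0 then 2 else 0)"
    using k0 unfolding eq by (rule potential)
  ultimately show ?thesis using x eq by (auto split: if_splits)
qed

lemma potential_off_circuit:
  assumes "is_circuit (range E) C" "E k \<notin> C" "x \<in> \<Union>C"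
  shows "T k x = 0"
proof -
  obtain e where e: "e \<in> C" "x \<in> e" using assms(3) by blast
  with assms(2) have "E k \<notin> C - {e}" "E k \<noteq> e" by auto
  then show ?thesis using circuit_potential[OF assms(1) e(1) _ e(2), of k] by simp
qed

text \<open>
  The value \<open>\<plusminus>1\<close> spreads from the edge \<open>k\<close> over the whole graph, as absolute values agree at the
  ends of all other edges.
\<close>

lemma potential_on_circuit:
  assumes "is_circuit (range E) C" "E k \<in> C"
  shows "\<bar>T k x\<bar> = 1"
proof (rule ccontr)
  assume x: "\<bar>T k x\<bar> \<noteq> 1"
  have Ek: "T k y = 1" if "y \<in> E k" for y using circuit_potential[OF assms, of k y] that by simp
  obtain a where "a \<in> E k" using card_edge[of k] by fastforce
  with Ek have "a \<in> {y. \<bar>T k y\<bar> = 1}" by simp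
  moreover have "x \<notin> {y. \<bar>T k y\<bar> = 1}" using x by simp
  ultimately obtain l y z
    where l: "E l = {y, z}" "y \<in> {y. \<bar>T k y\<bar> = 1}" "z \<notin> {y. \<bar>T k y\<bar> = 1}"
    by (rule leaving_edge)
  then have "l = k" using abs_potential[OF l(1), of k] by auto
  with l Ek[of z] show False by simp
qed

text \<open>
  The circuit is unique because it consists of the edges whose potential vanishes nowhere, a
  description that does not mention it.
\<close>

lemma the_circuit_is_circuit: "is_circuit (range E) (the_circuit (range E))"
proof -
  have "C = {E k | k. \<forall>x. T k x \<noteq> 0}" if C: "is_circuit (range E) C" for C
  proof -
    have "E k \<in> C \<longleftrightarrow> (\<forall>x. T k x \<noteq> 0)" for k
      using potential_on_circuit[OF C, of k] potential_off_circuit[OF C, of k] circuit_nonempty[OF C]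
      by (metis abs_zero zero_neq_one)
    moreover have "C \<subseteq> range E" using C by (simp add: is_circuit_def)
    ultimately show ?thesis by blast
  qed
  then show ?thesis
    unfolding the_circuit_def using circuit_exists by (metis (no_types, lifting) theI)
qed

text \<open>
  An edge \<open>k\<close> off the circuit is a bridge. Its potential vanishes on the side of the circuit, hence
  at one end of \<open>k\<close>, is \<open>2\<close> at the other end, and takes the values \<open>\<plusminus>2\<close> on the far side.
\<close>

lemma bridge_potential:
  assumes C: "is_circuit (range E) C" and k: "E k \<notin> C"
  obtains a b where "E k = {a, b}" "T k a = 0" "T k b = 2" "\<And>x. \<bar>T k x\<bar> \<in> {0, 2}"
proof -
  obtain c where "c \<in> \<Union>C" using circuit_nonempty[OF C] .
  then have c: "c \<in> {x. T k x = 0}" using potential_off_circuit[OF C k] by simp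
  obtain d where "d \<in> E k" "T k d \<noteq> 0"
  proof -
    obtain x y where "E k = {x, y}" using card_edge card_2_iff by metis
    with potential[of k x y k] that[of x] that[of y] show thesis by (cases "T k x = 0") auto
  qed
  then have "d \<notin> {x. T k x = 0}" by simp
  with c obtain l a b where l: "E l = {a, b}" "a \<in> {x. T k x = 0}" "b \<notin> {x. T k x = 0}"
    by (rule leaving_edge)
  then have "l = k" using abs_potential[OF l(1), of k] by auto
  with l have ab: "E k = {a, b}" "T k a = 0" "T k b = 2" using potential[of k a b k] by auto
  have "\<bar>T k x\<bar> \<in> {0, 2}" for x
  proof (rule ccontr)
    assume x: "\<bar>T k x\<bar> \<notin> {0, 2}"
    define S where "S = {y. \<bar>T k y\<bar> \<in> {0, 2}}"
    have "c \<in> S" "x \<notin> S" using c x by (auto simp: S_def)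
    then obtain l y z where l: "E l = {y, z}" "y \<in> S" "z \<notin> S"
      by (rule leaving_edge)
    then have "l = k" using abs_potential[OF l(1), of k] by (cases "l = k") (auto simp: S_def)
    with l ab show False by (auto simp: S_def doubleton_eq_iff)
  qed
  with ab show thesis by (rule that)
qed

text \<open>
  Only a bridge \<open>{a, b}\<close> has a potential with a spread of \<open>4\<close>, and the value \<open>-2\<close> it needs occurs
  exactly if the far end \<open>b\<close> has a further neighbor. That neighbor is at distance at least two from
  the circuit, and by connectedness some vertex is at distance two. Conversely a vertex \<open>t\<close> at
  distance two, reached from the circuit by \<open>c, s, t\<close>, makes the bridge \<open>{c, s}\<close> take the values \<open>2\<close>
  at \<open>s\<close> and \<open>-2\<close> at \<open>t\<close>.
\<close>

theorem wide_potential_iff_second_neighborhood: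
  "(\<exists>k x y. T k x - T k y \<ge> 4) \<longleftrightarrow>
   second_neighborhood (range E) (\<Union>(the_circuit (range E))) \<noteq> {}"
proof
  let ?C = "the_circuit (range E)"
  note C = the_circuit_is_circuit
  assume "\<exists>k x y. T k x - T k y \<ge> 4"
  then obtain k x y where wide: "T k x - T k y \<ge> 4" by blast
  have k: "E k \<notin> ?C"
    using potential_on_circuit[OF C, of k x] potential_on_circuit[OF C, of k y] wide by auto
  obtain a b where ab: "E k = {a, b}" "T k a = 0" "T k b = 2" and vals: "\<And>x. \<bar>T k x\<bar> \<in> {0, 2}"
    using bridge_potential[OF C k] by metis
  have y: "T k y = -2" using vals[of x] vals[of y] wide by auto
  \<comment> \<open>No edge other than \<open>k\<close> leaves the zero set, so an edge leaving \<open>S\<close> starts at \<open>b\<close>.\<close>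
  define S where "S = {x. T k x = 0} \<union> {b}"
  have "b \<in> S" "y \<notin> S" using y ab by (auto simp: S_def)
  then obtain l s t where l: "E l = {s, t}" "s \<in> S" "t \<notin> S" by (rule leaving_edge)
  then have "l \<noteq> k" using ab by (auto simp: S_def doubleton_eq_iff)
  then have "T k t = - T k s" using potential[OF l(1), of k] by simp
  then have "T k t = -2" using l ab by (auto simp: S_def)
  have t: "t \<notin> \<Union>?C" using potential_off_circuit[OF C k, of t] \<open>T k t = -2\<close> by auto
  have t': "{c, t} \<notin> range E" if "c \<in> \<Union>?C" for c
  proof
    assume "{c, t} \<in> range E"
    then obtain j where j: "E j = {c, t}" by (metis imageE)
    have "T k c = 0" using potential_off_circuit[OF C k that] .
    then show False using potential[OF j, of k] \<open>T k t = -2\<close> by (auto split: if_splits)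
  qed
  \<comment> \<open>An edge leaving the closed neighborhood of the circuit ends at distance exactly two.\<close>
  define N where "N = \<Union>?C \<union> {s. \<exists>c\<in>\<Union>?C. {c, s} \<in> range E}"
  obtain c where "c \<in> \<Union>?C" using circuit_nonempty[OF C] .
  then have "c \<in> N" by (simp add: N_def)
  moreover have "t \<notin> N" using t t' by (auto simp: N_def)
  ultimately obtain l s u where l: "E l = {s, u}" "s \<in> N" "u \<notin> N" by (rule leaving_edge)
  then have su: "{s, u} \<in> range E" by (metis rangeI)
  have "s \<notin> \<Union>?C"
  proof
    assume "s \<in> \<Union>?C"
    with su have "u \<in> N" unfolding N_def by blast
    with l(3) show False ..
  qed
  with l su have "u \<in> second_neighborhood (range E) (\<Union>?C)"
    unfolding second_neighborhood_iff by (auto simp: N_def)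
  then show "second_neighborhood (range E) (\<Union>?C) \<noteq> {}" by blast
next
  let ?C = "the_circuit (range E)"
  note C = the_circuit_is_circuit
  assume "second_neighborhood (range E) (\<Union>?C) \<noteq> {}"
  then obtain t c s where t: "t \<notin> \<Union>?C" "\<forall>x\<in>\<Union>?C. {x, t} \<notin> range E" and c: "c \<in> \<Union>?C"
    and cs: "{c, s} \<in> range E" and st: "{s, t} \<in> range E"
    unfolding ex_in_conv[symmetric] second_neighborhood_iff by blast
  obtain k l where k: "E k = {c, s}" and l: "E l = {s, t}" using cs st by (metis imageE)
  have s: "s \<notin> \<Union>?C" using t st by blast
  then have "E k \<notin> ?C" using k by auto
  then have "T k c = 0" using potential_off_circuit[OF C _ c] by blast
  then have "T k s = 2" using potential[OF k, of k] by simp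
  moreover have "k \<noteq> l" using k l c s t by (auto simp: doubleton_eq_iff)
  ultimately have "T k t = -2" using potential[OF l, of k] by simp
  with \<open>T k s = 2\<close> show "\<exists>k x y. T k x - T k y \<ge> 4" by (intro exI[of _ k] exI[of _ s] exI[of _ t]) simp
qed

end

section \<open>Squarefree quadratic Cremona sets\<close>

definition support :: "nat ^ 'n::finite \<Rightarrow> 'n set" where
  "support u = {x. u $ x \<noteq> 0}"

lemma sum_squarefree:
  assumes "squarefree_set v"
  shows "(\<Sum>l\<in>UNIV. int (v l $ x) * f l) = (\<Sum>l | x \<in> support (v l). f l)"
proof -
  have "v l $ x \<le> 1" for l using assms by (simp add: squarefree_set_def squarefree_monomial_def)
  then have "int (v l $ x) * f l = (if x \<in> support (v l) then f l else 0)" for l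
    using le_Suc_eq[of "v l $ x" 0] by (auto simp: support_def)
  then show ?thesis by (simp add: sum.If_cases)
qed

lemma card_support:
  assumes "squarefree_set v"
  shows "card (support (v l)) = mdeg (v l)"
proof -
  have "v l $ x \<le> 1" for x using assms by (simp add: squarefree_set_def squarefree_monomial_def)
  then have "v l $ x = (if x \<in> support (v l) then 1 else 0)" for x
    using le_Suc_eq[of "v l $ x" 0] by (auto simp: support_def)
  then have "mdeg (v l) = (\<Sum>x\<in>UNIV. if x \<in> support (v l) then 1 else 0)"
    unfolding mdeg_def by metis
  then show ?thesis by (simp add: sum.If_cases)
qed

lemma squarefree_eqI:
  assumes "squarefree_monomial u" "squarefree_monomial w" "support u = support w"
  shows "u = w"
proof -
  have "u $ x = w $ x" for x
  proof -
    have "u $ x \<le> 1" "w $ x \<le> 1" "u $ x \<noteq> 0 \<longleftrightarrow> w $ x \<noteq> 0"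
      using assms by (auto simp: squarefree_monomial_def support_def)
    then show ?thesis by linarith
  qed
  then show ?thesis by (simp add: vec_eq_iff)
qed

lemma graph_edges_eq:
  assumes sf: "squarefree_set v" and two: "in_degree 2 v"
  shows "graph_edges v = range (\<lambda>l. support (v l))"
proof
  show "graph_edges v \<subseteq> range (\<lambda>l. support (v l))"
  proof
    fix e assume "e \<in> graph_edges v"
    then obtain i j l where e: "e = {i, j}" and "v l = axis i 1 + axis j 1"
      unfolding graph_edges_def by fastforce
    then have "support (v l) = e" by (auto simp: support_def axis_def)
    then show "e \<in> range (\<lambda>l. support (v l))" by blast
  qed
next
  show "range (\<lambda>l. support (v l)) \<subseteq> graph_edges v"
  proof clarify
    fix l
    have "card (support (v l)) = 2" using card_support[OF sf] two by (simp add: in_degree_def)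
    then obtain i j where ij: "support (v l) = {i, j}" "i \<noteq> j" using card_2_iff by metis
    have "v l = axis i 1 + axis j 1"
    proof (rule squarefree_eqI)
      show "squarefree_monomial (v l)" using sf by (simp add: squarefree_set_def)
    qed (use ij in \<open>auto simp: support_def axis_def squarefree_monomial_def\<close>)
    then have "axis i 1 + axis j 1 \<in> range v" by (metis rangeI)
    with ij show "support (v l) \<in> graph_edges v" unfolding graph_edges_def by blast
  qed
qed

text \<open>
  For an edge \<open>{y, b}\<close> the vector \<open>2 e\<^sub>y = (e\<^sub>y + e\<^sub>b) + (e\<^sub>y - e\<^sub>b)\<close> is in the lattice of the edges, so
  twice the inverse of the log-matrix has integral entries. The law from the other side holds
  because a right inverse of a real square matrix is a left inverse.
\<close>

lemma cremona_half_integral_incidence: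
  fixes v :: "'n::finite \<Rightarrow> nat ^ 'n"
  assumes cremona: "cremona_set TYPE('k::field) v" and sf: "squarefree_set v"
    and two: "in_degree 2 v" and canon: "canonical_restrictions v"
  obtains T where "half_integral_incidence (\<lambda>l. support (v l)) T"
proof -
  let ?E = "\<lambda>l. support (v l)"
  have card: "card (?E l) = 2" for l
    using card_support[OF sf] two by (simp add: in_degree_def)
  have lattice: "\<exists>z :: 'n \<Rightarrow> int. \<forall>x. (\<Sum>l | x \<in> ?E l. z l)
      = (if x = a then 1 else 0) - (if x = b then 1 else 0)" for a b
  proof -
    have "birational (\<lambda>j. monomial (v j) :: ('k, 'n) mpoly)"
      using cremona by (simp add: cremona_set_def)
    then obtain z :: "'n \<Rightarrow> int" where "\<And>x. (\<Sum>l\<in>UNIV. int (v l $ x) * z l)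
        = (if x = a then 1 else 0) - (if x = b then 1 else 0)"
      using birational_monomials_lattice[of v a b] by blast
    then show ?thesis unfolding sum_squarefree[OF sf] by (intro exI allI)
  qed
  have "\<exists>t :: 'n \<Rightarrow> int. \<forall>x. (\<Sum>l | x \<in> ?E l. t l) = (if x = y then 2 else 0)" for y
  proof -
    obtain l where "monomial_dvd (axis y 1) (v l)"
      using canon unfolding canonical_restrictions_def by blast
    then have "1 \<le> v l $ y" unfolding monomial_dvd_def by (metis axis_nth)
    then have "y \<in> ?E l" by (simp add: support_def)
    then obtain b where b: "?E l = {y, b}" "y \<noteq> b"
      using card[of l] by (metis card_2_iff doubleton_eq_iff empty_iff insert_iff)
    obtain z :: "'n \<Rightarrow> int" where z: "\<And>x. (\<Sum>l | x \<in> ?E l. z l)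
      = (if x = y then 1 else 0) - (if x = b then 1 else 0)"
      using lattice by blast
    have "(\<Sum>j | x \<in> ?E j. z j + (if j = l then 1 else 0)) = (if x = y then 2 else 0)" for x
      using b by (auto simp: sum.distrib z)
    then show ?thesis by (intro exI allI)
  qed
  then obtain t :: "'n \<Rightarrow> 'n \<Rightarrow> int"
    where t: "\<And>y x. (\<Sum>l | x \<in> ?E l. t y l) = (if x = y then 2 else 0)" by metis
  define T where "T k y = t y k" for k y
  have dual: "(\<Sum>k | x \<in> ?E k. T k y) = (if x = y then 2 else 0)" for x y
    unfolding T_def by (rule t)
  have inv: "(\<Sum>x\<in>?E l. T k x) = (if k = l then 2 else 0)" for k l
  proof -
    define A :: "real ^ 'n ^ 'n" where "A = (\<chi> x k. if x \<in> ?E k then 1 else 0)"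
    define B :: "real ^ 'n ^ 'n" where "B = (\<chi> k x. of_int (T k x) / 2)"
    have "A ** B = mat 1"
    proof -
      have "(A ** B) $ x $ y = mat 1 $ x $ y" for x y
      proof -
        have "(A ** B) $ x $ y = (\<Sum>k\<in>UNIV. if x \<in> ?E k then of_int (T k y) / 2 else 0)"
          by (auto simp: matrix_matrix_mult_def A_def B_def intro!: sum.cong)
        also have "\<dots> = of_int (\<Sum>k | x \<in> ?E k. T k y) / 2"
          by (simp add: sum.If_cases sum_divide_distrib)
        finally show ?thesis unfolding dual by (cases "x = y") (simp_all add: mat_def)
      qed
      then show ?thesis by (simp add: vec_eq_iff)
    qed
    then have "B ** A = mat 1" by (simp add: matrix_left_right_inverse)
    then have "(B ** A) $ k $ l = (if k = l then 1 else 0)" by (simp add: mat_def)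
    moreover have "(B ** A) $ k $ l = (\<Sum>x\<in>UNIV. if x \<in> ?E l then of_int (T k x) / 2 else 0)"
      by (auto simp: matrix_matrix_mult_def A_def B_def intro!: sum.cong)
    moreover have "\<dots> = of_int (\<Sum>x\<in>?E l. T k x) / 2"
      by (simp add: sum.If_cases sum_divide_distrib)
    ultimately have "real_of_int (\<Sum>x\<in>?E l. T k x) = of_int (if k = l then 2 else 0)"
      by (simp split: if_splits)
    then show ?thesis by (simp only: of_int_eq_iff)
  qed
  have "half_integral_incidence ?E T"
  proof
    show "card (?E l) = 2" for l by (rule card)
    show "T k a + T k b = (if k = l then 2 else 0)" if "?E l = {a, b}" for k l a b
    proof -
      have "a \<noteq> b" using card[of l] that by auto
      then show ?thesis using inv[of k l] that by simp
    qed
    show "(\<Sum>k | x \<in> ?E k. T k y) = (if x = y then 2 else 0)" for x y by (rule dual)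
    show "even (T k x - T k y)" for k x y
    proof -
      obtain z :: "'n \<Rightarrow> int" where z: "\<And>a. (\<Sum>l | a \<in> ?E l. z l)
        = (if a = x then 1 else 0) - (if a = y then 1 else 0)"
        using lattice by blast
      have "(\<Sum>a\<in>UNIV. T k a * ((if a = x then 1 else 0) - (if a = y then 1 else 0)))
          = (\<Sum>a\<in>UNIV. (if a = x then T k a else 0) - (if a = y then T k a else 0))"
        by (rule sum.cong) auto
      also have "\<dots> = T k x - T k y" by (simp add: sum_subtractf)
      finally show ?thesis using left_inverse_pairing[of "T k" ?E k z, OF inv] unfolding z
        by (metis dvd_triv_left)
    qed
  qed
  then show thesis by (rule that)
qed

section \<open>The inverse set\<close>

lemma log_matrix_product_iff:
  assumes "squarefree_set v"
  shows "log_matrix v ** log_matrix w = (\<chi> i j. \<gamma> $ i) + mat 1 \<longleftrightarrow>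
    (\<forall>x j. (\<Sum>l | x \<in> support (v l). int (w j $ l)) = int (\<gamma> $ x) + (if x = j then 1 else 0))"
proof -
  have entry: "int ((log_matrix v ** log_matrix w) $ x $ j)
      = (\<Sum>l | x \<in> support (v l). int (w j $ l))" for x j
    unfolding sum_squarefree[OF assms, symmetric] by (simp add: matrix_matrix_mult_def log_matrix_def)
  have rhs: "int (((\<chi> i j. \<gamma> $ i) + mat 1) $ x $ j) = int (\<gamma> $ x) + (if x = j then 1 else 0)" for x j
    by (simp add: mat_def)
  show ?thesis
    unfolding vec_eq_iff entry[symmetric] rhs[symmetric] of_nat_eq_iff ..
qed

text \<open>
  The defining equation fixes the differences \<open>w\<^sub>i - w\<^sub>j\<close>, as the log-matrix is invertible and maps
  them to \<open>e\<^sub>i - e\<^sub>j\<close>; so \<open>2 w\<^sub>i(k) - T k i\<close> does not depend on \<open>i\<close>. As the monomials have no common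
  factor, the minimum over \<open>i\<close> of \<open>w\<^sub>i(k)\<close> is \<open>0\<close>. These two facts give the formula for every inverse
  set. Existence has to be shown as well, by checking that the formula defines one, because
  \<open>inverse_set\<close> is a definite description.
\<close>

lemma inverse_set_entries:
  fixes v :: "'n::finite \<Rightarrow> nat ^ 'n"
  assumes two: "CARD('n) \<ge> 2" and sf: "squarefree_set v"
    and inc: "half_integral_incidence (\<lambda>l. support (v l)) T"
  shows "2 * int (inverse_set v j $ k) = T k j - Min (range (T k))"
proof -
  let ?E = "\<lambda>l. support (v l)"
  interpret half_integral_incidence ?E T by (fact inc)
  have entries: "2 * int (w j $ k) = T k j - Min (range (T k))" if w: "is_inverse_set v w" for w j k
  proof -
    obtain \<gamma> where \<gamma>: "\<And>x j. (\<Sum>l | x \<in> ?E l. int (w j $ l)) = int (\<gamma> $ x) + (if x = j then 1 else 0)"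
      using w unfolding is_inverse_set_def log_matrix_product_iff[OF sf] by blast
    have diff: "2 * int (w i $ k) - T k i = (\<Sum>x\<in>UNIV. T k x * int (\<gamma> $ x))" for i
    proof -
      have "2 * int (w i $ k) = (\<Sum>x\<in>UNIV. T k x * (int (\<gamma> $ x) + (if x = i then 1 else 0)))"
        using solve_incidence[of k "\<lambda>l. int (w i $ l)"] unfolding \<gamma> by simp
      also have "\<dots> = (\<Sum>x\<in>UNIV. T k x * int (\<gamma> $ x)) + (\<Sum>x\<in>UNIV. if x = i then T k x else 0)"
        unfolding sum.distrib[symmetric] by (rule sum.cong) (auto simp: distrib_left)
      finally show ?thesis by simp
    qed
    have "\<exists>i. w i $ k = 0"
    proof (rule ccontr)
      assume "\<not> ?thesis"
      then have "\<forall>i. monomial_dvd (axis k 1) (w i)" by (auto simp: monomial_dvd_def axis_def Suc_le_eq)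
      then have "axis k 1 = (0 :: nat ^ 'n)"
        using w by (auto simp: is_inverse_set_def canonical_restrictions_def)
      then show False by (metis axis_nth zero_index zero_neq_one)
    qed
    then obtain i where i: "w i $ k = 0" ..
    have "Min (range (T k)) = T k i"
    proof (rule Min_eqI)
      fix y assume "y \<in> range (T k)"
      then obtain x where "y = T k x" by blast
      then show "T k i \<le> y" using diff[of i] diff[of x] i by simp
    qed auto
    then show ?thesis using diff[of i] diff[of j] i by simp
  qed
  have "\<exists>w. is_inverse_set v w"
  proof -
    define w :: "'n \<Rightarrow> nat ^ 'n" where "w j = (\<chi> k. nat ((T k j - Min (range (T k))) div 2))" for j
    have w: "2 * int (w j $ k) = T k j - Min (range (T k))" for j k
    proof -
      have "Min (range (T k)) \<in> range (T k)" by (rule Min_in) auto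
      then obtain i where i: "Min (range (T k)) = T k i" by blast
      moreover have "Min (range (T k)) \<le> T k j" by (rule Min_le) auto
      ultimately show ?thesis using parity[of k j i] by (simp add: w_def)
    qed
    have sum_w: "2 * (\<Sum>l | x \<in> ?E l. int (w j $ l))
        = (if x = j then 2 else 0) - (\<Sum>l | x \<in> ?E l. Min (range (T l)))" for x j
      unfolding sum_distrib_left w by (simp add: sum_subtractf dual)
    have ex_other: "\<exists>y. y \<noteq> x" for x :: 'n
    proof (rule ccontr)
      assume "\<nexists>y. y \<noteq> x"
      then have "UNIV = {x}" by blast
      then have "CARD('n) = 1" by (metis card_1_singleton_iff One_nat_def)
      with two show False by simp
    qed
    then obtain other where other: "\<And>x :: 'n. other x \<noteq> x" using ex_other by metis
    \<comment> \<open>The entry in row \<open>x\<close> off the diagonal; an off-diagonal column exists as there are at least two variables.\<close>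
    define \<gamma> :: "nat ^ 'n" where "\<gamma> = (\<chi> x. \<Sum>l | x \<in> ?E l. w (other x) $ l)"
    have "(\<Sum>l | x \<in> ?E l. int (w j $ l)) = int (\<gamma> $ x) + (if x = j then 1 else 0)" for x j
      using sum_w[of j x] sum_w[of "other x" x] other[of x] by (auto simp: \<gamma>_def)
    then have product: "\<exists>\<gamma>. log_matrix v ** log_matrix w = (\<chi> i j. \<gamma> $ i) + mat 1"
      unfolding log_matrix_product_iff[OF sf] by blast
    have "inj w"
    proof
      fix i j assume "w i = w j"
      then have "(\<Sum>l | i \<in> ?E l. int (w i $ l)) = (\<Sum>l | i \<in> ?E l. int (w j $ l))" by simp
      then show "i = j" using sum_w[of i i] sum_w[of j i] by (auto split: if_splits)
    qed
    moreover have "mdeg (w i) = mdeg (w j)" for i j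
    proof -
      have "2 * int (mdeg (w j)) = 1 - (\<Sum>k\<in>UNIV. Min (range (T k)))" for j
        unfolding mdeg_def of_nat_sum sum_distrib_left w by (simp add: sum_subtractf column_sum)
      from this[of i] this[of j] show ?thesis by simp
    qed
    ultimately have "equigenerated w" unfolding equigenerated_def by metis
    moreover have "canonical_restrictions w"
      unfolding canonical_restrictions_def
    proof (intro conjI allI impI)
      fix u assume u: "\<forall>j. monomial_dvd u (w j)"
      have "u $ k = 0" for k
      proof -
        have "Min (range (T k)) \<in> range (T k)" by (rule Min_in) auto
        then obtain i where "Min (range (T k)) = T k i" by blast
        with w[of i k] have "w i $ k = 0" by simp
        with u show ?thesis by (metis le_zero_eq monomial_dvd_def)
      qed
      then show "u = 0" by (simp add: vec_eq_iff)
    next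
      fix k
      \<comment> \<open>A constant potential would be \<open>1\<close> by the edge \<open>k\<close> and \<open>0\<close> by any other edge.\<close>
      have "\<exists>j. w j $ k \<noteq> 0"
      proof (rule ccontr)
        assume "\<not> ?thesis"
        then have const: "T k j = Min (range (T k))" for j using w[of j k] by simp
        obtain l where "l \<noteq> k" using ex_other by blast
        obtain a b where "?E k = {a, b}" using card_edge card_2_iff by metis
        then have "Min (range (T k)) = 1" using potential[of k a b k] const[of a] const[of b] by simp
        moreover obtain c d where "?E l = {c, d}" using card_edge card_2_iff by metis
        then have "Min (range (T k)) = 0"
          using potential[of l c d k] const[of c] const[of d] \<open>l \<noteq> k\<close> by simp
        ultimately show False by simp
      qed
      then show "\<exists>j. monomial_dvd (axis k 1) (w j)"
        by (auto simp: monomial_dvd_def axis_def Suc_le_eq)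
    qed
    ultimately show ?thesis using product unfolding is_inverse_set_def by blast
  qed
  then obtain w where w: "is_inverse_set v w" ..
  have "w' = w" if "is_inverse_set v w'" for w'
  proof (intro ext)
    fix j
    show "w' j = w j" unfolding vec_eq_iff
    proof
      fix k
      show "w' j $ k = w j $ k" using entries[OF w, of j k] entries[OF that, of j k] by simp
    qed
  qed
  with w have "is_inverse_set v (inverse_set v)" unfolding inverse_set_def by (rule theI)
  then show ?thesis by (rule entries)
qed

lemma apocryphal_iff_wide_potential:
  fixes v :: "'n::finite \<Rightarrow> nat ^ 'n"
  assumes "CARD('n) \<ge> 2" "squarefree_set v"
    and "half_integral_incidence (\<lambda>l. support (v l)) T"
  shows "apocryphal v \<longleftrightarrow> (\<exists>k x y. T k x - T k y \<ge> 4)"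
proof -
  have "\<not> inverse_set v j $ k \<le> 1 \<longleftrightarrow> (\<exists>y. T k j - T k y \<ge> 4)" for j k
  proof -
    have "\<not> inverse_set v j $ k \<le> 1 \<longleftrightarrow> Min (range (T k)) \<le> T k j - 4"
      using inverse_set_entries[OF assms, of j k] by linarith
    also have "\<dots> \<longleftrightarrow> (\<exists>y. T k j - T k y \<ge> 4)"
      by (subst Min_le_iff) (auto simp: algebra_simps)
    finally show ?thesis .
  qed
  then show ?thesis unfolding apocryphal_def squarefree_monomial_def by blast
qed

theorem corollary2p11:
  fixes v :: "'n::finite \<Rightarrow> nat ^ 'n"
  assumes "CARD('n) \<ge> 2"
    and "cremona_set TYPE('k::field) v"
    and "squarefree_set v"
    and "in_degree 2 v"
    and "canonical_restrictions v"
  shows "apocryphal v \<longleftrightarrow> general_type v"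
proof -
  obtain T where inc: "half_integral_incidence (\<lambda>l. support (v l)) T"
    using assms(2-5) by (rule cremona_half_integral_incidence)
  interpret half_integral_incidence "\<lambda>l. support (v l)" T by (fact inc)
  show ?thesis
    unfolding apocryphal_iff_wide_potential[OF assms(1,3) inc] wide_potential_iff_second_neighborhood
      general_type_def short_type_def graph_edges_eq[OF assms(3,4)] ..
qed

end
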